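(* Let $n = |\mathcal{S}|$, let $P^\pi \in \mathbb{R}^{n\times n}$ be a row-stochastic matrix, and let $\Phi^* \in \mathbb{R}^{n\times k}$ be an optimal representation spanning the principal subspace of $P^\pi$ (as defined in the context). Let $u_1 = \alpha\mathbf{1}$, with $\alpha \in \mathbb{R}\setminus\{0\}$, be the constant vector, which corresponds to the dominant mode of $P^\pi$ (the eigenvalue $1$, with $P^\pi u_1 = u_1$). Let $\Phi^*_{\mathrm{proj},u_1}$ denote the projection of $\Phi^*$ onto $u_1$, and let $H = I_n - \frac{1}{n}\mathbf{1}\mathbf{1}^\top$ be the zero-centering matrix. Then the zero-centering operation eliminates this projection: $$\| H\, \Phi^*_{\mathrm{proj},u_1} \|_2 = 0 .$$
   Context: Setting: $\mathcal{S}$ is a finite state space with $n=|\mathcal{S}|$ states, and $\pi$ is a policy inducing the state transition matrix $P^\pi \in \mathbb{R}^{n\times n}$. Row-stochastic means that all entries are nonnegative and every row sums to $1$. The vector $\mathbf{1}\in\mathbb{R}^n$ is the column vector of ones, and $I_m$ is the $m\times m$ identity matrix. A representation matrix is $\Phi\in\mathbb{R}^{n\times k}$, whose row indexed by a state $s$ is the embedding $\phi(s)\in\mathbb{R}^k$ of that state. Optimal representation: $\Phi^*$ is a maximizer of $$\max_{\Phi\in\mathbb{R}^{n\times k}} \operatorname{Tr}\left((\Phi^\top P^\pi \Phi)^\top(\Phi^\top P^\pi\Phi)\right)\quad\text{subject to}\quad \Phi^\top\Phi = I_k ,$$ and it spans the principal subspace of $P^\pi$, meaning that the column space of $\Phi^*$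 is the subspace spanned by the top-$k$ right eigenvectors $u_1,\dots,u_k$ of $P^\pi$, with eigenpairs $(\lambda_i,u_i)$ ordered by $|\lambda_1|\ge|\lambda_2|\ge\cdots$, where $\lambda_1 = 1$ and $u_1=\alpha\mathbf{1}$. This spanning property is taken as part of the hypothesis on $\Phi^*$. Projection onto $u_1$: with the orthogonal projector $\Pi_{u_1} = \frac{u_1u_1^\top}{u_1^\top u_1}$ onto $\operatorname{span}(u_1)$, define $\Phi^*_{\mathrm{proj},u_1} = \Pi_{u_1}\Phi^*\in\mathbb{R}^{n\times k}$. Zero-centering: left multiplication by $H$ subtracts from each column of a matrix the mean of that column. The norm $\|\cdot\|_2$ is the matrix 2-norm (spectral norm). *)

theory Defs
  imports "HOL-Analysis.Analysis"
begin

definition row_stochastic :: "real ^ 's ^ 's \<Rightarrow> bool" where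
  "row_stochastic P \<longleftrightarrow> (\<forall>i j. 0 \<le> P $ i $ j) \<and> (\<forall>i. (\<Sum>j\<in>UNIV. P $ i $ j) = 1)"

definition representation_objective :: "real ^ 's ^ 's \<Rightarrow> real ^ 'k ^ 's \<Rightarrow> real" where
  "representation_objective P \<Phi> =
     trace (transpose (transpose \<Phi> ** P ** \<Phi>) ** (transpose \<Phi> ** P ** \<Phi>))"

definition complex_vec :: "real ^ 's \<Rightarrow> complex ^ 's" where
  "complex_vec v = (\<chi> i. complex_of_real (v $ i))"

definition eigenpair :: "complex ^ 's ^ 's \<Rightarrow> complex \<Rightarrow> complex ^ 's \<Rightarrow> bool" where
  "eigenpair A \<mu> v \<longleftrightarrow> v \<noteq> 0 \<and> A *v v = \<mu> *s v"

text \<open>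
  A transition matrix is real but need be neither symmetric nor diagonalizable, so the eigenpairs
  are complex, and the enumeration \<open>(ev 1, u 1), \<dots>, (ev m, u m)\<close> by decreasing modulus runs
  through a maximal linearly independent family of right eigenvectors (\<open>m = CARD('s)\<close> if
  and only if the matrix is diagonalizable over the complex numbers). Here \<open>vec.span\<close> and
  \<open>vec.independent\<close> are taken over the complex numbers.
\<close>

definition ordered_eigenpairs ::
    "complex ^ 's ^ 's \<Rightarrow> nat \<Rightarrow> (nat \<Rightarrow> complex) \<Rightarrow> (nat \<Rightarrow> complex ^ 's) \<Rightarrow> bool" where
  "ordered_eigenpairs A m ev u \<longleftrightarrow>
     (\<forall>i\<in>{1..m}. eigenpair A (ev i) (u i)) \<and>
     inj_on u {1..m} \<and> vec.independent (u ` {1..m}) \<and>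
     (\<forall>\<mu> v. eigenpair A \<mu> v \<longrightarrow> v \<in> vec.span (u ` {1..m})) \<and>
     (\<forall>i\<in>{1..m}. \<forall>j\<in>{1..m}. i \<le> j \<longrightarrow> cmod (ev j) \<le> cmod (ev i))"

text \<open>
  The column space of the real matrix \<open>\<Phi>\<close> is compared with the span of the leading eigenvectors
  after extension of scalars, because these eigenvectors may be non-real. The last argument is the
  first eigenvector, which belongs to the eigenvalue 1.
\<close>

definition spans_principal_subspace ::
    "real ^ 's ^ 's \<Rightarrow> real ^ 'k ^ 's \<Rightarrow> real ^ 's \<Rightarrow> bool" where
  "spans_principal_subspace P \<Phi> u\<^sub>1 \<longleftrightarrow>
     (\<exists>m ev u. CARD('k) \<le> m \<and> ordered_eigenpairs (map_matrix complex_of_real P) m ev u \<and>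
        ev 1 = 1 \<and> u 1 = complex_vec u\<^sub>1 \<and>
        vec.span (columns (map_matrix complex_of_real \<Phi>)) = vec.span (u ` {1..CARD('k)}))"

definition optimal_representation ::
    "real ^ 's ^ 's \<Rightarrow> real ^ 'k ^ 's \<Rightarrow> real ^ 's \<Rightarrow> bool" where
  "optimal_representation P \<Phi> u\<^sub>1 \<longleftrightarrow>
     is_arg_max (representation_objective P) (\<lambda>\<Psi>. transpose \<Psi> ** \<Psi> = mat 1) \<Phi> \<and>
     spans_principal_subspace P \<Phi> u\<^sub>1"

definition outer :: "real ^ 's \<Rightarrow> real ^ 'm \<Rightarrow> real ^ 'm ^ 's" where
  "outer v w = (\<chi> i j. v $ i * w $ j)"

definition orth_projector :: "real ^ 's \<Rightarrow> real ^ 's ^ 's" where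
  "orth_projector u = (1 / (u \<bullet> u)) *\<^sub>R outer u u"

text \<open>In \<^term>\<open>outer 1 1\<close> the two arguments are the all-ones vector.\<close>

definition zero_centering :: "real ^ 's ^ 's" where
  "zero_centering = mat 1 - (1 / real CARD('s)) *\<^sub>R outer 1 1"

definition spectral_norm :: "real ^ 'm ^ 's \<Rightarrow> real" where
  "spectral_norm A = onorm ((*v) A)"

end

theory Submission
  imports Defs
begin

text \<open>The projector onto \<open>u\<^sub>1\<close> is a multiple of the rank-one matrix
  \<open>outer u\<^sub>1 u\<^sub>1\<close>, and a matrix acts on an outer product through its left
  factor (\<open>matrix_mult_outer\<close>). Centering kills constant vectors
  (\<open>zero_centering_one\<close>), so it kills the projector, whatever matrix follows.\<close>

lemma matrix_mult_outer: "A ** outer v w = outer (A *v v) w"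
  by (simp add: outer_def matrix_matrix_mult_def matrix_vector_mult_def vec_eq_iff
      sum_distrib_right mult.assoc)

text \<open>Each row of \<open>outer 1 1\<close> sums to \<open>CARD('s)\<close>, which the factor
  \<open>1 / real CARD('s)\<close> cancels.\<close>

lemma zero_centering_one: "zero_centering *v (1 :: real ^ 's) = 0"
  by (simp add: zero_centering_def matrix_vector_mult_diff_rdistrib
      scaleR_matrix_vector_assoc[symmetric])
    (simp add: outer_def matrix_vector_mult_def vec_eq_iff)

lemma zero_centering_orth_projector:
  "zero_centering ** orth_projector (\<alpha> *\<^sub>R (1 :: real ^ 's)) = 0"
  by (simp add: orth_projector_def matrix_scalar_ac matrix_mult_outer
      matrix_vector_mult_scaleR zero_centering_one scaleR_matrix_vector_assoc[symmetric])
    (simp add: outer_def vec_eq_iff)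

theorem proposition2:
  fixes P :: "real ^ 's ^ 's" and \<Phi> :: "real ^ 'k ^ 's" and u\<^sub>1 :: "real ^ 's" and \<alpha> :: real
  assumes "row_stochastic P"
    and "\<alpha> \<noteq> 0" and "u\<^sub>1 = \<alpha> *\<^sub>R 1" and "P *v u\<^sub>1 = u\<^sub>1"
    and "optimal_representation P \<Phi> u\<^sub>1"
  shows "spectral_norm (zero_centering ** (orth_projector u\<^sub>1 ** \<Phi>)) = 0"
proof -
  have "zero_centering ** (orth_projector u\<^sub>1 ** \<Phi>) = 0"
    \<comment> \<open>Reassociating lets the centering matrix meet the projector before
      \<open>\<Phi>\<close>.\<close>
    by (simp add: assms(3) matrix_mul_assoc zero_centering_orth_projector)
  then show ?thesis
    by (simp add: spectral_norm_def onorm_eq_0 matrix_vector_mul_bounded_linear)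
qed

end
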